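(* Let $f\in\mathcal{LC}_n$, let $i\in[n]$, and suppose $f_{\{i\}}>0$. Define the conditioned polynomial $$f^{(i)}(t):=\frac1{f_{\{i\}}}\,\frac{\partial f}{\partial t_i},$$ viewed as an element of the squarefree algebra on the variables $\{t_j:j\ne i\}$. Then $f^{(i)}\in\mathcal{LC}_{n-1}$.
   Context: $[n]=\{1,\dots,n\}$. The squarefree algebra $\mathcal{A}_n:=\mathbb{R}[t_1,\dots,t_n]/(t_1^2,\dots,t_n^2)$ has basis $\{t^S: S\subseteq[n]\}$ with $t^S:=\prod_{i\in S}t_i$, $t^\varnothing=1$; write $f=\sum_{S\subseteq[n]}f_S t^S$ with $f_S\in\mathbb{R}$, and identify $f$ with this multiaffine polynomial (so $\partial f/\partial t_i=\sum_{S\subseteq[n]\setminus\{i\}}f_{S\cup\{i\}}t^S$). For $f\in\mathcal{A}_n$ with $f_\varnothing=1$, define $\log f:=\sum_{k=1}^n\frac{(-1)^{k+1}}{k}(f-1)^k=\sum_{\varnothing\ne S\subseteq[n]}\kappa_S(f)\,t^S$. $\mathcal{LC}_n$ is the set of $f\in\mathcal{A}_n$ with $f_S\ge0$ for all $S\subseteq[n]$, $f_\varnothing=1$, and $\kappa_S(f)\le0$ for all $S\subseteq[n]$ with $|S|\ge2$. Here membership of $f^{(i)}$ in $\mathcal{LC}_{n-1}$ means the same conditions with the index set $[n]\setminus\{i\}$ (of size $n-1$) in place of $[n-1]$. *)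

theory Defs
  imports Complex_Main
begin

text \<open>
  The type \<open>'v sqfree\<close> is the algebra of squarefree polynomials with real coefficients in
  variables \<open>t\<^sub>i\<close>, \<open>i :: 'v\<close>, subject to \<open>t\<^sub>i\<^sup>2 = 0\<close>. An element is given by its coefficients
  in the basis \<open>t\<^sup>S\<close>, with \<open>S\<close> ranging over the finite sets of variables. The algebra
  \<open>\<real>[t\<^sub>i : i \<in> I] / (t\<^sub>i\<^sup>2 : i \<in> I)\<close> is the subalgebra \<open>sqfree_on I\<close> below:
  it is generated by the \<open>t\<^sub>i\<close> with \<open>i \<in> I\<close>, these square to 0, and the products
  \<open>t\<^sup>S = (\<Prod>i\<in>S. t\<^sub>i)\<close>, \<open>S \<subseteq> I\<close> finite, form a basis (\<open>var_square\<close>,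
  \<open>coef_prod_var\<close>, \<open>sqfree_on_expansion\<close>).
\<close>

typedef 'v sqfree =
  "{f :: 'v set \<Rightarrow> real. finite {S. f S \<noteq> 0} \<and> (\<forall>S. f S \<noteq> 0 \<longrightarrow> finite S)}"
  morphisms coef Abs_sqfree
  by (rule exI[of _ "\<lambda>_. 0"]) simp

setup_lifting type_definition_sqfree

lemma sqfree_eqI: "(\<And>S. coef f S = coef g S) \<Longrightarrow> f = g"
  by (rule coef_inject[THEN iffD1]) (rule ext)

lemma finite_coef_support: "finite {S. coef f S \<noteq> 0}"
  using coef[of f] by simp

lemma coef_infinite: "infinite S \<Longrightarrow> coef f S = 0"
  using coef[of f] by auto

lemma sqfree_mult_assoc_aux:
  fixes f g h :: "'v set \<Rightarrow> real"
  assumes "finite S"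
  shows "(\<Sum>T\<in>Pow S. (\<Sum>U\<in>Pow T. f U * g (T - U)) * h (S - T)) =
         (\<Sum>U\<in>Pow S. f U * (\<Sum>V\<in>Pow (S - U). g V * h (S - U - V)))"
proof -
  have fin: "finite (Pow T)" if "T \<in> Pow S" for T
    using assms that by (auto intro: finite_subset)
  have fin': "finite (Pow (S - U))" for U
    using assms by simp
  have diff: "S - U - (T - U) = S - T" if "U \<subseteq> T" for T U
    using that by auto
  have "(\<Sum>T\<in>Pow S. (\<Sum>U\<in>Pow T. f U * g (T - U)) * h (S - T)) =
        (\<Sum>(T, U)\<in>(SIGMA T:Pow S. Pow T). f U * g (T - U) * h (S - T))"
    using fin assms by (simp add: sum_distrib_right sum.Sigma)
  also have "\<dots> = (\<Sum>(U, V)\<in>(SIGMA U:Pow S. Pow (S - U)). f U * (g V * h (S - U - V)))"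
    by (rule sum.reindex_bij_witness
          [where i = "\<lambda>(U, V). (U \<union> V, U)" and j = "\<lambda>(T, U). (U, T - U)"])
       (use diff in \<open>auto simp: mult.assoc\<close>)
  also have "\<dots> = (\<Sum>U\<in>Pow S. f U * (\<Sum>V\<in>Pow (S - U). g V * h (S - U - V)))"
    using fin' assms by (simp add: sum_distrib_left sum.Sigma)
  finally show ?thesis .
qed

instantiation sqfree :: (type) "{comm_ring_1, real_algebra_1}"
begin

lift_definition zero_sqfree :: "'a sqfree" is "\<lambda>_. 0" by simp

lift_definition one_sqfree :: "'a sqfree" is "\<lambda>S. if S = {} then 1 else 0" by simp

lift_definition plus_sqfree :: "'a sqfree \<Rightarrow> 'a sqfree \<Rightarrow> 'a sqfree"
  is "\<lambda>f g S. f S + g S"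
proof -
  fix f g :: "'a set \<Rightarrow> real"
  assume a: "finite {S. f S \<noteq> 0} \<and> (\<forall>S. f S \<noteq> 0 \<longrightarrow> finite S)"
    and b: "finite {S. g S \<noteq> 0} \<and> (\<forall>S. g S \<noteq> 0 \<longrightarrow> finite S)"
  have "finite {S. f S + g S \<noteq> 0}"
    by (rule finite_subset[of _ "{S. f S \<noteq> 0} \<union> {S. g S \<noteq> 0}"]) (use a b in auto)
  moreover have "finite S" if "f S + g S \<noteq> 0" for S
    using a b that by (cases "f S = 0") auto
  ultimately show "finite {S. f S + g S \<noteq> 0} \<and> (\<forall>S. f S + g S \<noteq> 0 \<longrightarrow> finite S)"
    by blast
qed

lift_definition uminus_sqfree :: "'a sqfree \<Rightarrow> 'a sqfree" is "\<lambda>f S. - f S" by simp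

lift_definition minus_sqfree :: "'a sqfree \<Rightarrow> 'a sqfree \<Rightarrow> 'a sqfree"
  is "\<lambda>f g S. f S - g S"
proof -
  fix f g :: "'a set \<Rightarrow> real"
  assume a: "finite {S. f S \<noteq> 0} \<and> (\<forall>S. f S \<noteq> 0 \<longrightarrow> finite S)"
    and b: "finite {S. g S \<noteq> 0} \<and> (\<forall>S. g S \<noteq> 0 \<longrightarrow> finite S)"
  have "finite {S. f S - g S \<noteq> 0}"
    by (rule finite_subset[of _ "{S. f S \<noteq> 0} \<union> {S. g S \<noteq> 0}"]) (use a b in auto)
  moreover have "finite S" if "f S - g S \<noteq> 0" for S
    using a b that by (cases "f S = 0") auto
  ultimately show "finite {S. f S - g S \<noteq> 0} \<and> (\<forall>S. f S - g S \<noteq> 0 \<longrightarrow> finite S)"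
    by blast
qed

lift_definition scaleR_sqfree :: "real \<Rightarrow> 'a sqfree \<Rightarrow> 'a sqfree" is "\<lambda>c f S. c * f S"
proof -
  fix c and f :: "'a set \<Rightarrow> real"
  assume a: "finite {S. f S \<noteq> 0} \<and> (\<forall>S. f S \<noteq> 0 \<longrightarrow> finite S)"
  have "finite {S. c * f S \<noteq> 0}"
    by (rule finite_subset[of _ "{S. f S \<noteq> 0}"]) (use a in auto)
  then show "finite {S. c * f S \<noteq> 0} \<and> (\<forall>S. c * f S \<noteq> 0 \<longrightarrow> finite S)"
    using a by simp
qed

text \<open>
  The bilinear extension of \<open>t\<^sup>T * t\<^sup>U = t\<^sup>T\<^sup>\<union>\<^sup>U\<close> for disjoint \<open>T\<close>, \<open>U\<close> and
  \<open>t\<^sup>T * t\<^sup>U = 0\<close> otherwise: the coefficient of \<open>t\<^sup>S\<close> collects the splittings of \<open>S\<close>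
  into \<open>T\<close> and \<open>S - T\<close>. For infinite \<open>S\<close> the index set is infinite and the sum is 0.
\<close>

lift_definition times_sqfree :: "'a sqfree \<Rightarrow> 'a sqfree \<Rightarrow> 'a sqfree"
  is "\<lambda>f g S. \<Sum>T\<in>Pow S. f T * g (S - T)"
proof -
  fix f g :: "'a set \<Rightarrow> real"
  assume a: "finite {S. f S \<noteq> 0} \<and> (\<forall>S. f S \<noteq> 0 \<longrightarrow> finite S)"
    and b: "finite {S. g S \<noteq> 0} \<and> (\<forall>S. g S \<noteq> 0 \<longrightarrow> finite S)"
  let ?h = "\<lambda>S. \<Sum>T\<in>Pow S. f T * g (S - T)"
  have "{S. ?h S \<noteq> 0} \<subseteq> (\<lambda>(T, U). T \<union> U) ` ({S. f S \<noteq> 0} \<times> {S. g S \<noteq> 0})"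
  proof
    fix S assume "S \<in> {S. ?h S \<noteq> 0}"
    then obtain T where T: "T \<in> Pow S" "f T * g (S - T) \<noteq> 0"
      by (metis (mono_tags, lifting) mem_Collect_eq sum.neutral)
    then show "S \<in> (\<lambda>(T, U). T \<union> U) ` ({S. f S \<noteq> 0} \<times> {S. g S \<noteq> 0})"
      by (intro image_eqI[of _ _ "(T, S - T)"]) auto
  qed
  then have "finite {S. ?h S \<noteq> 0}"
    by (rule finite_subset) (simp add: a b)
  moreover have "finite S" if "?h S \<noteq> 0" for S
    using that by (metis finite_Pow_iff sum.infinite)
  ultimately show "finite {S. ?h S \<noteq> 0} \<and> (\<forall>S. ?h S \<noteq> 0 \<longrightarrow> finite S)"
    by blast
qed

instance
proof
  fix a b c :: "'a sqfree" and x y :: real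
  show "a * b * c = a * (b * c)"
  proof (rule sqfree_eqI)
    fix S show "coef (a * b * c) S = coef (a * (b * c)) S"
      by (cases "finite S") (simp_all add: times_sqfree.rep_eq sqfree_mult_assoc_aux)
  qed
  show "a * b = b * a"
  proof (rule sqfree_eqI)
    fix S
    have "(\<Sum>T\<in>Pow S. coef a T * coef b (S - T)) = (\<Sum>T\<in>Pow S. coef b T * coef a (S - T))"
      by (rule sum.reindex_bij_witness[where i = "\<lambda>T. S - T" and j = "\<lambda>T. S - T"])
         (auto simp: double_diff)
    then show "coef (a * b) S = coef (b * a) S"
      by (simp add: times_sqfree.rep_eq)
  qed
  show "1 * a = a"
  proof (rule sqfree_eqI)
    fix S show "coef (1 * a) S = coef a S"
    proof (cases "finite S")
      case True
      have "(\<Sum>T\<in>Pow S. (if T = {} then 1 else 0) * coef a (S - T)) =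
            (\<Sum>T\<in>Pow S. if T = {} then coef a S else 0)"
        by (rule sum.cong) auto
      then show ?thesis
        using True by (simp add: times_sqfree.rep_eq one_sqfree.rep_eq)
    qed (simp add: coef_infinite)
  qed
  show "(a + b) * c = a * c + b * c"
    by (rule sqfree_eqI)
       (simp add: times_sqfree.rep_eq plus_sqfree.rep_eq distrib_right sum.distrib)
  show "x *\<^sub>R a * b = x *\<^sub>R (a * b)"
    by (rule sqfree_eqI)
       (simp add: times_sqfree.rep_eq scaleR_sqfree.rep_eq sum_distrib_left mult.assoc)
  show "a * x *\<^sub>R b = x *\<^sub>R (a * b)"
    by (rule sqfree_eqI)
       (simp add: times_sqfree.rep_eq scaleR_sqfree.rep_eq sum_distrib_left ac_simps)
  show "(0 :: 'a sqfree) \<noteq> 1"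
    by transfer (auto simp: fun_eq_iff)
  show "a * (b + c) = a * b + a * c"
    by (rule sqfree_eqI)
       (simp add: times_sqfree.rep_eq plus_sqfree.rep_eq distrib_left sum.distrib)
  show "a * 1 = a"
  proof (rule sqfree_eqI)
    fix S show "coef (a * 1) S = coef a S"
    proof (cases "finite S")
      case True
      have "(\<Sum>T\<in>Pow S. coef a T * (if S - T = {} then 1 else 0)) =
            (\<Sum>T\<in>Pow S. if T = S then coef a S else 0)"
        by (rule sum.cong) auto
      then show ?thesis
        using True by (simp add: times_sqfree.rep_eq one_sqfree.rep_eq)
    qed (simp add: coef_infinite)
  qed
  show "a + b + c = a + (b + c)" by (rule sqfree_eqI) (simp add: plus_sqfree.rep_eq)
  show "a + b = b + a" by (rule sqfree_eqI) (simp add: plus_sqfree.rep_eq)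
  show "0 + a = a" by (rule sqfree_eqI) (simp add: plus_sqfree.rep_eq zero_sqfree.rep_eq)
  show "- a + a = 0"
    by (rule sqfree_eqI) (simp add: plus_sqfree.rep_eq uminus_sqfree.rep_eq zero_sqfree.rep_eq)
  show "a - b = a + - b"
    by (rule sqfree_eqI) (simp add: plus_sqfree.rep_eq uminus_sqfree.rep_eq minus_sqfree.rep_eq)
  show "x *\<^sub>R (a + b) = x *\<^sub>R a + x *\<^sub>R b"
    by (rule sqfree_eqI) (simp add: plus_sqfree.rep_eq scaleR_sqfree.rep_eq distrib_left)
  show "(x + y) *\<^sub>R a = x *\<^sub>R a + y *\<^sub>R a"
    by (rule sqfree_eqI) (simp add: plus_sqfree.rep_eq scaleR_sqfree.rep_eq distrib_right)
  show "x *\<^sub>R y *\<^sub>R a = (x * y) *\<^sub>R a"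
    by (rule sqfree_eqI) (simp add: scaleR_sqfree.rep_eq)
  show "1 *\<^sub>R a = a" by (rule sqfree_eqI) (simp add: scaleR_sqfree.rep_eq)
qed

end

lemma coef_simps [simp]:
  "coef 0 S = 0"
  "coef 1 S = (if S = {} then 1 else 0)"
  "coef (f + g) S = coef f S + coef g S"
  "coef (f - g) S = coef f S - coef g S"
  "coef (- f) S = - coef f S"
  "coef (c *\<^sub>R f) S = c * coef f S"
  by (simp_all add: zero_sqfree.rep_eq one_sqfree.rep_eq plus_sqfree.rep_eq
        minus_sqfree.rep_eq uminus_sqfree.rep_eq scaleR_sqfree.rep_eq)

lemma coef_mult: "coef (f * g) S = (\<Sum>T\<in>Pow S. coef f T * coef g (S - T))"
  by (simp add: times_sqfree.rep_eq)

lemma coef_sum [simp]: "coef (sum f A) S = (\<Sum>x\<in>A. coef (f x) S)"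
  by (induction A rule: infinite_finite_induct) auto

lift_definition var :: "'v \<Rightarrow> 'v sqfree" is "\<lambda>i S. if S = {i} then 1 else 0" by simp

lemma var_square: "var i * var i = 0"
proof (rule sqfree_eqI)
  fix S show "coef (var i * var i) S = coef 0 S"
    unfolding coef_mult by (auto simp: var.rep_eq intro!: sum.neutral)
qed

lemma coef_var_mult:
  "coef (var i * f) S = (if i \<in> S then coef f (S - {i}) else 0)"
proof (cases "finite S")
  case True
  have "coef (var i * f) S = (\<Sum>T\<in>Pow S. if T = {i} then coef f (S - {i}) else 0)"
    unfolding coef_mult by (rule sum.cong) (auto simp: var.rep_eq)
  with True show ?thesis by simp
qed (simp add: coef_infinite)

lemma coef_prod_var:
  assumes "finite T"
  shows "coef (\<Prod>i\<in>T. var i) S = (if S = T then 1 else 0)"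
  using assms
proof (induction T arbitrary: S rule: finite_induct)
  case (insert i T)
  have iff: "(i \<in> S \<and> S - {i} = T) = (S = insert i T)"
    using insert.hyps by blast
  have "coef (\<Prod>i\<in>insert i T. var i) S = (if i \<in> S \<and> S - {i} = T then 1 else 0)"
    by (simp add: coef_var_mult insert.IH insert.hyps)
  then show ?case unfolding iff .
qed simp

definition sqfree_on :: "'v set \<Rightarrow> 'v sqfree set" where
  "sqfree_on I = {f. \<forall>S. coef f S \<noteq> 0 \<longrightarrow> S \<subseteq> I}"

lemma sqfree_on_subalgebra:
  "1 \<in> sqfree_on I"
  "i \<in> I \<Longrightarrow> var i \<in> sqfree_on I"
  "f \<in> sqfree_on I \<Longrightarrow> c *\<^sub>R f \<in> sqfree_on I"
  "f \<in> sqfree_on I \<Longrightarrow> g \<in> sqfree_on I \<Longrightarrow> f + g \<in> sqfree_on I"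
  by (force simp: sqfree_on_def var.rep_eq split: if_splits)+

lemma sqfree_on_mult:
  assumes "f \<in> sqfree_on I" "g \<in> sqfree_on I"
  shows "f * g \<in> sqfree_on I"
  unfolding sqfree_on_def
proof (intro CollectI allI impI)
  fix S assume "coef (f * g) S \<noteq> 0"
  then obtain T where "T \<subseteq> S" "coef f T * coef g (S - T) \<noteq> 0"
    unfolding coef_mult by (metis (no_types, lifting) PowD sum.neutral)
  then have "T \<subseteq> I" "S - T \<subseteq> I"
    using assms by (auto simp: sqfree_on_def)
  then show "S \<subseteq> I" by blast
qed

lemma sqfree_on_expansion:
  assumes "finite I" "f \<in> sqfree_on I"
  shows "f = (\<Sum>S\<in>Pow I. coef f S *\<^sub>R (\<Prod>i\<in>S. var i))"
proof (rule sqfree_eqI)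
  fix S
  have "(\<Sum>T\<in>Pow I. coef f T * coef (\<Prod>i\<in>T. var i) S) =
        (\<Sum>T\<in>Pow I. if T = S then coef f S else 0)"
  proof (rule sum.cong)
    fix T assume "T \<in> Pow I"
    then have "finite T"
      using assms(1) by (auto intro: finite_subset)
    then show "coef f T * coef (\<Prod>i\<in>T. var i) S = (if T = S then coef f S else 0)"
      by (simp add: coef_prod_var)
  qed simp
  also have "\<dots> = coef f S"
    using assms by (auto simp: sqfree_on_def)
  finally show "coef f S = coef (\<Sum>S\<in>Pow I. coef f S *\<^sub>R (\<Prod>i\<in>S. var i)) S"
    by simp
qed

text \<open>
  The formal derivative with respect to \<open>t\<^sub>i\<close> of the multiaffine polynomial with the
  coefficients of \<open>f\<close>. It is not a derivation for the product above.
\<close>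

lift_definition pderiv_sqfree :: "'v \<Rightarrow> 'v sqfree \<Rightarrow> 'v sqfree"
  is "\<lambda>i f S. if i \<in> S then 0 else f (insert i S)"
proof -
  fix i and f :: "'v set \<Rightarrow> real"
  assume a: "finite {S. f S \<noteq> 0} \<and> (\<forall>S. f S \<noteq> 0 \<longrightarrow> finite S)"
  let ?h = "\<lambda>S. if i \<in> S then 0 else f (insert i S)"
  have "{S. ?h S \<noteq> 0} \<subseteq> (\<lambda>S. S - {i}) ` {S. f S \<noteq> 0}"
  proof
    fix S assume "S \<in> {S. ?h S \<noteq> 0}"
    then have "i \<notin> S" "f (insert i S) \<noteq> 0"
      by (auto split: if_splits)
    then show "S \<in> (\<lambda>S. S - {i}) ` {S. f S \<noteq> 0}"
      by (intro image_eqI[where x = "insert i S"]) simp_all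
  qed
  then have "finite {S. ?h S \<noteq> 0}"
    by (rule finite_subset) (simp add: a)
  moreover have "finite S" if "?h S \<noteq> 0" for S
    using a that by (metis (full_types) finite_insert)
  ultimately show "finite {S. ?h S \<noteq> 0} \<and> (\<forall>S. ?h S \<noteq> 0 \<longrightarrow> finite S)"
    by blast
qed

text \<open>
  The logarithm on \<open>sqfree_on I\<close>, meant for finite \<open>I\<close> and \<open>coef f {} = 1\<close>; the series
  is cut off at \<open>k = card I\<close>.
\<close>

definition sqfree_log :: "'v set \<Rightarrow> 'v sqfree \<Rightarrow> 'v sqfree" where
  "sqfree_log I f = (\<Sum>k=1..card I. ((-1) ^ (k + 1) / real k) *\<^sub>R (f - 1) ^ k)"

definition kappa :: "'v set \<Rightarrow> 'v sqfree \<Rightarrow> 'v set \<Rightarrow> real" where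
  "kappa I f S = coef (sqfree_log I f) S"

definition LC :: "'v set \<Rightarrow> 'v sqfree set" where
  "LC I = {f \<in> sqfree_on I.
     (\<forall>S\<subseteq>I. coef f S \<ge> 0) \<and> coef f {} = 1 \<and>
     (\<forall>S\<subseteq>I. card S \<ge> 2 \<longrightarrow> kappa I f S \<le> 0)}"

definition conditioned :: "'v \<Rightarrow> 'v sqfree \<Rightarrow> 'v sqfree" where
  "conditioned i f = (1 / coef f {i}) *\<^sub>R pderiv_sqfree i f"

end

theory Submission
  imports Defs
begin

text \<open>
  Write \<open>f = a + t\<^sub>i b\<close> with \<open>a\<close>, \<open>b\<close> free of \<open>t\<^sub>i\<close>. Then \<open>log f = log a + t\<^sub>i b/a\<close>, so
  \<open>b = a g\<close> with \<open>g = \<partial>(log f)/\<partial>t\<^sub>i\<close>. By assumption \<open>g\<close> has constant term \<open>f\<^sub>i\<close> and no other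
  positive coefficient, so \<open>g/f\<^sub>i = 1 - h\<close> with \<open>h\<close> nonnegative, and
  \<open>log (b/f\<^sub>i) = log a + log (1 - h) = log a - \<Sum>\<^sub>k h\<^sup>k/k\<close>, where the coefficients of \<open>log a\<close>
  are among those of \<open>log f\<close>. Identities between logarithms are
  checked through \<open>f D(log f) = D f\<close> for the derivations \<open>D t\<^sup>S = w(S) t\<^sup>S\<close> with \<open>w\<close> additive.
\<close>

section \<open>Diagonal derivations and restriction of variables\<close>

text \<open>Two weights matter: constant 1 gives the Euler operator, which sees every coefficient
  except the constant term; the indicator of i gives
  \<open>t\<^sub>i \<partial>/\<partial>t\<^sub>i\<close>, a derivation, unlike
  \<open>pderiv_sqfree\<close>.\<close>

lift_definition euler_deriv :: "('v \<Rightarrow> real) \<Rightarrow> 'v sqfree \<Rightarrow> 'v sqfree"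
  is "\<lambda>w f S. sum w S * f S"
  by (auto elim: finite_subset[rotated])

text \<open>The substitution of 0 for the variables outside J, hence multiplicative and compatible
  with the diagonal derivations.\<close>

lift_definition restrict_sqfree :: "'v set \<Rightarrow> 'v sqfree \<Rightarrow> 'v sqfree"
  is "\<lambda>J f S. if S \<subseteq> J then f S else 0"
  by (auto elim: finite_subset[rotated])

lemmas coef_euler_deriv = euler_deriv.rep_eq
lemmas coef_restrict = restrict_sqfree.rep_eq
lemmas coef_pderiv = pderiv_sqfree.rep_eq

lemma euler_deriv_linear:
  "euler_deriv w (f + g) = euler_deriv w f + euler_deriv w g"
  "euler_deriv w (f - g) = euler_deriv w f - euler_deriv w g"
  "euler_deriv w (c *\<^sub>R f) = c *\<^sub>R euler_deriv w f"
  "euler_deriv w (sum F A) = (\<Sum>x\<in>A. euler_deriv w (F x))"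
  by (rule sqfree_eqI; simp add: coef_euler_deriv algebra_simps sum_distrib_left)+

lemma euler_deriv_0 [simp]: "euler_deriv w 0 = 0"
  by (rule sqfree_eqI) (simp add: coef_euler_deriv)

lemma euler_deriv_1 [simp]: "euler_deriv w 1 = 0"
  by (rule sqfree_eqI) (simp add: coef_euler_deriv)

lemma euler_deriv_mult:
  "euler_deriv w (f * g) = euler_deriv w f * g + f * euler_deriv w g"
proof (rule sqfree_eqI)
  fix S
  show "coef (euler_deriv w (f * g)) S = coef (euler_deriv w f * g + f * euler_deriv w g) S"
  proof (cases "finite S")
    case True
    have "sum w S = sum w T + sum w (S - T)" if "T \<in> Pow S" for T
      using that True by (metis PowD add.commute sum.subset_diff)
    then have "sum w S * (coef f T * coef g (S - T)) =
        coef (euler_deriv w f) T * coef g (S - T) + coef f T * coef (euler_deriv w g) (S - T)"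
      if "T \<in> Pow S" for T
      using that by (simp add: coef_euler_deriv algebra_simps)
    then have "(\<Sum>T\<in>Pow S. sum w S * (coef f T * coef g (S - T))) =
        (\<Sum>T\<in>Pow S. coef (euler_deriv w f) T * coef g (S - T) +
                     coef f T * coef (euler_deriv w g) (S - T))"
      by (intro sum.cong) simp_all
    then show ?thesis
      by (simp only: coef_euler_deriv[of w "f * g"] coef_mult coef_simps sum_distrib_left sum.distrib)
  qed (simp add: coef_infinite)
qed

lemma euler_deriv_power_Suc:
  "euler_deriv w (f ^ Suc k) = real (Suc k) *\<^sub>R (f ^ k * euler_deriv w f)"
proof (induction k)
  case (Suc k)
  have "euler_deriv w (f ^ Suc (Suc k)) =
        euler_deriv w f * f ^ Suc k + f * euler_deriv w (f ^ Suc k)"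
    by (simp add: euler_deriv_mult)
  also have "\<dots> = (1 + real (Suc k)) *\<^sub>R (f ^ Suc k * euler_deriv w f)"
    unfolding Suc.IH scaleR_add_left by (simp add: ac_simps)
  finally show ?case by simp
qed simp

lemma euler_deriv_restrict:
  "euler_deriv w (restrict_sqfree J f) = restrict_sqfree J (euler_deriv w f)"
  by (rule sqfree_eqI) (simp add: coef_euler_deriv coef_restrict)

lemma restrict_sqfree_mult:
  "restrict_sqfree J (f * g) = restrict_sqfree J f * restrict_sqfree J g"
proof (rule sqfree_eqI)
  fix S
  show "coef (restrict_sqfree J (f * g)) S = coef (restrict_sqfree J f * restrict_sqfree J g) S"
  proof (cases "S \<subseteq> J")
    case True
    then have "T \<subseteq> J" "S - T \<subseteq> J" if "T \<in> Pow S" for T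
      using that by auto
    with True show ?thesis
      by (simp add: coef_restrict coef_mult)
  next
    case False
    then have "\<not> T \<subseteq> J \<or> \<not> S - T \<subseteq> J" for T
      by blast
    then have "coef (restrict_sqfree J f * restrict_sqfree J g) S = 0"
      by (auto simp: coef_restrict coef_mult intro!: sum.neutral)
    with False show ?thesis
      by (simp add: coef_restrict)
  qed
qed

section \<open>Nilpotents and units\<close>

lemma sqfree_on_diff: "f \<in> sqfree_on I \<Longrightarrow> g \<in> sqfree_on I \<Longrightarrow> f - g \<in> sqfree_on I"
  by (force simp: sqfree_on_def)

lemma sqfree_on_power: "f \<in> sqfree_on I \<Longrightarrow> f ^ k \<in> sqfree_on I"
  by (induction k) (auto intro: sqfree_on_mult sqfree_on_subalgebra)

lemma sqfree_log_in_sqfree_on: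
  assumes "f \<in> sqfree_on I"
  shows "sqfree_log I f \<in> sqfree_on I"
proof -
  have "(f - 1) ^ k \<in> sqfree_on I" for k
    using assms by (intro sqfree_on_power sqfree_on_diff sqfree_on_subalgebra)
  then have "coef ((f - 1) ^ k) S = 0" if "\<not> S \<subseteq> I" for S k
    using that by (auto simp: sqfree_on_def)
  then have "coef (sqfree_log I f) S = 0" if "\<not> S \<subseteq> I" for S
    using that by (simp add: sqfree_log_def del: coef_simps(4))
  then show ?thesis
    unfolding sqfree_on_def by blast
qed

text \<open>The coefficient sums over splittings of S into k nonempty blocks, and there are none
  when k exceeds the size of S.\<close>

lemma coef_power_eq_0:
  assumes "coef u {} = 0" "card S < k"
  shows "coef (u ^ k) S = 0"
  using assms(2)
proof (induction k arbitrary: S)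
  case (Suc k)
  show ?case
  proof (cases "finite S")
    case True
    have "coef u T * coef (u ^ k) (S - T) = 0" if "T \<in> Pow S" for T
    proof (cases "T = {}")
      case False
      with that True have "card (S - T) < card S"
        by (intro psubset_card_mono) auto
      with Suc show ?thesis by simp
    qed (simp add: assms)
    then show ?thesis
      unfolding power_Suc coef_mult by (rule sum.neutral[OF ballI])
  qed (simp add: coef_infinite)
qed simp

lemma sqfree_power_eq_0:
  assumes "finite I" "u \<in> sqfree_on I" "coef u {} = 0"
  shows "u ^ Suc (card I) = 0"
proof (rule sqfree_eqI)
  fix S
  show "coef (u ^ Suc (card I)) S = coef 0 S"
  proof (cases "S \<subseteq> I")
    case True
    with assms(1) have "card S < Suc (card I)"
      by (simp add: card_mono less_Suc_eq_le)
    with assms(3) show ?thesis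
      by (simp only: coef_power_eq_0 coef_simps)
  next
    case False
    with sqfree_on_power[OF assms(2), of "Suc (card I)"] show ?thesis
      by (auto simp: sqfree_on_def)
  qed
qed

text \<open>The geometric series in 1 - f terminates because 1 - f is nilpotent.\<close>

lemma sqfree_unit:
  assumes "finite I" "f \<in> sqfree_on I" "coef f {} = 1"
  obtains g where "g * f = 1"
proof
  have "1 - f \<in> sqfree_on I"
    using assms by (intro sqfree_on_diff sqfree_on_subalgebra)
  then have "(1 - f) ^ Suc (card I) = 0"
    using assms by (intro sqfree_power_eq_0) auto
  then show "(\<Sum>k<Suc (card I). (1 - f) ^ k) * f = 1"
    using one_diff_power_eq[of "1 - f" "Suc (card I)"] by (simp add: mult.commute)
qed

section \<open>The logarithmic derivative\<close>

lemma uminus_power_scaleR: "(- u) ^ k = (- 1) ^ k *\<^sub>R u ^ k"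
  for u :: "'a :: real_algebra_1"
  by (induction k) simp_all

text \<open>With v = 1 - f, differentiating the truncated series gives a geometric sum times D f;
  multiplication by f = 1 - v telescopes it.\<close>

lemma mult_euler_deriv_log:
  assumes "finite I" "f \<in> sqfree_on I" "coef f {} = 1"
  shows "f * euler_deriv w (sqfree_log I f) = euler_deriv w f"
proof -
  let ?v = "1 - f" and ?m = "card I"
  have "?v \<in> sqfree_on I"
    using assms by (intro sqfree_on_diff sqfree_on_subalgebra)
  then have "?v ^ Suc ?m = 0"
    using assms by (intro sqfree_power_eq_0) auto
  then have "euler_deriv w (?v ^ Suc ?m) = 0"
    by simp
  \<comment> \<open>The power \<open>?v ^ ?m\<close> itself can be nonzero. Differentiating the next
    power, which is 0, shows that its product with D f vanishes, so the cut-off at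
    \<open>card I\<close> leaves no error term.\<close>
  then have v0: "?v ^ ?m * euler_deriv w f = 0"
    by (simp only: euler_deriv_power_Suc euler_deriv_linear euler_deriv_1) simp
  have neg: "(f - 1) ^ k = (- 1) ^ k *\<^sub>R ?v ^ k" for k
    using uminus_power_scaleR[of ?v k] by simp
  have "sqfree_log I f = (\<Sum>k<?m. (- 1 / real (Suc k)) *\<^sub>R ?v ^ Suc k)"
    unfolding sqfree_log_def neg
    by (rule sum.reindex_bij_witness[where i = Suc and j = "\<lambda>k. k - 1"])
       (auto simp flip: power_add mult_2)
  then have "euler_deriv w (sqfree_log I f) = (\<Sum>k<?m. ?v ^ k * euler_deriv w f)"
    by (simp only: euler_deriv_linear euler_deriv_power_Suc euler_deriv_1) simp
  then have "f * euler_deriv w (sqfree_log I f) =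
             ((1 - ?v) * (\<Sum>k<?m. ?v ^ k)) * euler_deriv w f"
    by (simp add: sum_distrib_right mult.assoc)
  also have "\<dots> = (1 - ?v ^ ?m) * euler_deriv w f"
    by (simp only: one_diff_power_eq)
  also have "\<dots> = euler_deriv w f"
    using v0 by (simp add: left_diff_distrib)
  finally show ?thesis .
qed

text \<open>Since f is a unit, the equation determines the Euler derivative of M, and dividing by
  the size of S recovers each nonconstant coefficient.\<close>

lemma coef_sqfree_log_unique:
  assumes "finite I" "f \<in> sqfree_on I" "coef f {} = 1"
    and "f * euler_deriv (\<lambda>_. 1) M = euler_deriv (\<lambda>_. 1) f"
    and "finite S" "S \<noteq> {}"
  shows "coef (sqfree_log I f) S = coef M S"
proof -
  obtain g where g: "g * f = 1"
    using assms(1-3) by (rule sqfree_unit)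
  have "g * (f * euler_deriv (\<lambda>_. 1) (sqfree_log I f)) = g * (f * euler_deriv (\<lambda>_. 1) M)"
    using mult_euler_deriv_log[OF assms(1-3)] assms(4) by simp
  then have "euler_deriv (\<lambda>_. 1) (sqfree_log I f) = euler_deriv (\<lambda>_. 1) M"
    by (simp add: g flip: mult.assoc)
  from arg_cong[OF this, of "\<lambda>h. coef h S"]
  have "real (card S) * coef (sqfree_log I f) S = real (card S) * coef M S"
    by (simp add: coef_euler_deriv)
  with assms(5,6) show ?thesis by simp
qed

section \<open>Signs of coefficients and the partial derivative of the logarithm\<close>

lemma coef_power_nonneg:
  assumes "\<And>S. coef h S \<ge> 0"
  shows "coef (h ^ k) S \<ge> 0"
  by (induction k arbitrary: S) (auto simp: coef_mult assms intro!: sum_nonneg)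

lemma coef_log_one_minus_nonpos:
  assumes "\<And>S. coef h S \<ge> 0"
  shows "coef (sqfree_log I (1 - h)) S \<le> 0"
proof -
  have "(- 1) ^ (k + 1) / real k * ((- 1) ^ k * coef (h ^ k) S) \<le> 0" for k
    using coef_power_nonneg[OF assms, of k S]
    by (simp flip: power_add mult_2 mult.assoc)
  then show ?thesis
    unfolding sqfree_log_def coef_sum
    by (intro sum_nonpos) (simp add: uminus_power_scaleR[of h])
qed

text \<open>Compare coefficients at \<open>insert i S\<close> in f D(log f) = D f, where D is the
  derivation weighted by the indicator of i.\<close>

lemma pderiv_log:
  assumes "finite I" "f \<in> sqfree_on I" "coef f {} = 1"
  shows "pderiv_sqfree i f = restrict_sqfree (I - {i}) f * pderiv_sqfree i (sqfree_log I f)"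
proof (rule sqfree_eqI)
  fix S
  let ?L = "sqfree_log I f" and ?w = "\<lambda>j. if j = i then 1 else 0 :: real"
  let ?a = "restrict_sqfree (I - {i}) f" and ?g = "pderiv_sqfree i (sqfree_log I f)"
  show "coef (pderiv_sqfree i f) S = coef (?a * ?g) S"
  proof (cases "finite S \<and> i \<notin> S")
    case True
    have w: "coef (euler_deriv ?w h) T = (if i \<in> T then coef h T else 0)" for h T
      by (cases "finite T") (simp_all add: coef_euler_deriv coef_infinite)
    have "coef (pderiv_sqfree i f) S = coef (f * euler_deriv ?w ?L) (insert i S)"
      using True by (simp add: mult_euler_deriv_log[OF assms] w coef_pderiv)
    also have "\<dots> = (\<Sum>T\<in>Pow S. coef f T * coef (euler_deriv ?w ?L) (insert i S - T))"
      \<comment> \<open>If T contains i, its complement in \<open>insert i S\<close> does not, and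
        D(log f) has coefficient 0 there.\<close>
      unfolding coef_mult using True by (intro sum.mono_neutral_right) (auto simp: w)
    also have "\<dots> = (\<Sum>T\<in>Pow S. coef ?a T * coef ?g (S - T))"
    proof (rule sum.cong)
      fix T assume T: "T \<in> Pow S"
      then have iT: "i \<notin> T" using True by auto
      then have "coef ?a T = coef f T"
        using assms(2) by (auto simp: coef_restrict sqfree_on_def)
      moreover have "insert i S - T = insert i (S - T)"
        using iT by auto
      ultimately show "coef f T * coef (euler_deriv ?w ?L) (insert i S - T) =
                       coef ?a T * coef ?g (S - T)"
        using True by (simp add: w coef_pderiv)
    qed simp
    finally show ?thesis by (simp add: coef_mult)
  next
    case False
    \<comment> \<open>Whichever of T and S - T contains i, the corresponding factor
      vanishes.\<close>
    have "coef ?a T * coef ?g (S - T) = 0" if "i \<in> S" for T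
      using that by (cases "i \<in> T") (auto simp: coef_restrict coef_pderiv)
    with False have "coef (?a * ?g) S = 0"
      by (cases "finite S") (simp_all add: coef_mult sum.neutral del: mult_eq_0_iff)
    moreover have "coef (pderiv_sqfree i f) S = 0"
      using False by (auto simp: coef_pderiv coef_infinite)
    ultimately show ?thesis by simp
  qed
qed

section \<open>Closure under conditioning\<close>

lemma conditioned_in_LC:
  assumes "finite I" "f \<in> LC I" "i \<in> I" "coef f {i} > 0"
  shows "conditioned i f \<in> LC (I - {i})"
proof -
  let ?J = "I - {i}" and ?L = "sqfree_log I f" and ?N = "euler_deriv (\<lambda>_. 1)"
  define c where "c = conditioned i f"
  define a where "a = restrict_sqfree ?J f"
  define q where "q = (1 / coef f {i}) *\<^sub>R pderiv_sqfree i ?L"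
  have f: "f \<in> sqfree_on I" "coef f {} = 1" "\<And>S. S \<subseteq> I \<Longrightarrow> coef f S \<ge> 0"
    and kappa: "\<And>S. S \<subseteq> I \<Longrightarrow> card S \<ge> 2 \<Longrightarrow> coef ?L S \<le> 0"
    using assms(2) by (auto simp: LC_def kappa_def)
  have finJ: "finite ?J" using assms(1) by simp
  have coef_c: "coef c S = (if i \<in> S then 0 else coef f (insert i S) / coef f {i})" for S
    by (simp add: c_def conditioned_def coef_pderiv)
  have c_on: "c \<in> sqfree_on ?J"
    using f(1) by (auto simp: sqfree_on_def coef_c split: if_splits)
  have c1: "coef c {} = 1"
    using assms(4) by (simp add: coef_c)
  have caq: "c = a * q"
    by (simp add: c_def conditioned_def a_def q_def pderiv_log[OF assms(1) f(1,2)])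
  have a1: "coef a {} = 1"
    using f(2) by (simp add: a_def coef_restrict)
  have q1: "coef q {} = 1"
    using c1 a1 by (simp add: caq coef_mult)
  have L_on: "?L \<in> sqfree_on I"
    using f(1) by (rule sqfree_log_in_sqfree_on)
  then have q_on: "q \<in> sqfree_on ?J"
    by (auto simp: sqfree_on_def q_def coef_pderiv split: if_splits)
  \<comment> \<open>Adding i to a nonempty S gives a set of size at least 2, where the sign
    hypothesis on log f applies; so even singletons S are covered. At the empty set the coefficient
    is 0 by the normalization of q.\<close>
  have h: "coef (1 - q) S \<ge> 0" for S
  proof (cases "S \<noteq> {} \<and> S \<subseteq> ?J")
    case True
    then have "finite S" using finJ finite_subset by blast
    then have "card S > 0"
      using True by (simp add: card_gt_0_iff)
    moreover have "i \<notin> S"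
      using True by auto
    ultimately have "card (insert i S) \<ge> 2"
      using \<open>finite S\<close> by simp
    with True assms(3) have "coef ?L (insert i S) \<le> 0"
      by (intro kappa) auto
    with True assms(4) show ?thesis
      by (auto simp: q_def coef_pderiv divide_le_0_iff)
  next
    case False
    then consider "S = {}" | "coef q S = 0"
      using q_on unfolding sqfree_on_def by blast
    then show ?thesis
      using q1 by cases simp_all
  qed
  have "f * ?N ?L = ?N f"
    by (rule mult_euler_deriv_log[OF assms(1) f(1,2)])
  \<comment> \<open>The restriction of log f serves as log a. Working with its derivative avoids
    comparing series cut off at \<open>card I\<close> and at \<open>card ?J\<close>.\<close>
  then have Na: "a * ?N (restrict_sqfree ?J ?L) = ?N a"
    by (simp add: a_def euler_deriv_restrict flip: restrict_sqfree_mult)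
  have Nq: "q * ?N (sqfree_log ?J q) = ?N q"
    by (rule mult_euler_deriv_log[OF finJ q_on q1])
  \<comment> \<open>By the product rule, logarithmic derivatives add over c = a q.\<close>
  have "c * ?N (restrict_sqfree ?J ?L + sqfree_log ?J q) =
        (a * ?N (restrict_sqfree ?J ?L)) * q + a * (q * ?N (sqfree_log ?J q))"
    by (simp add: caq euler_deriv_linear algebra_simps)
  also have "\<dots> = ?N c"
    by (simp only: Na Nq caq euler_deriv_mult)
  finally have Nc: "c * ?N (restrict_sqfree ?J ?L + sqfree_log ?J q) = ?N c" .
  have "kappa ?J c S \<le> 0" if "S \<subseteq> ?J" "card S \<ge> 2" for S
  proof -
    have "finite S" "S \<noteq> {}"
      using that finJ by (auto intro: finite_subset)
    then have "kappa ?J c S = coef ?L S + coef (sqfree_log ?J q) S"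
      using that coef_sqfree_log_unique[OF finJ c_on c1 Nc]
      by (simp add: kappa_def coef_restrict)
    moreover have "coef ?L S \<le> 0"
      using that by (intro kappa) auto
    moreover have "coef (sqfree_log ?J q) S \<le> 0"
      using coef_log_one_minus_nonpos[of "1 - q" ?J S] h by simp
    ultimately show ?thesis by simp
  qed
  moreover have "coef c S \<ge> 0" if "S \<subseteq> ?J" for S
  proof -
    have "coef f (insert i S) \<ge> 0"
      using that assms(3) by (intro f(3)) auto
    with assms(4) show ?thesis by (simp add: coef_c)
  qed
  ultimately have "c \<in> LC ?J"
    using c_on c1 by (simp add: LC_def)
  then show ?thesis by (simp add: c_def)
qed

theorem proposition5p6:
  fixes n i :: nat and f :: "nat sqfree"
  assumes "f \<in> LC {1..n}"
    and "i \<in> {1..n}"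
    and "coef f {i} > 0"
  shows "conditioned i f \<in> LC ({1..n} - {i})"
  using assms by (intro conditioned_in_LC) simp_all

end
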